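(* Let $p$ be a prime and let $1\le\alpha_1\le\alpha_2$ be integers. For every integer $\alpha$ with $0\le\alpha\le\alpha_1+\alpha_2$, the number of all subgroups of order $p^{\alpha_1+\alpha_2-\alpha}$ in the finite abelian $p$-group $\mathbb{Z}_{p^{\alpha_1}}\times\mathbb{Z}_{p^{\alpha_2}}$ is $$\begin{cases}\dfrac{p^{\alpha+1}-1}{p-1}, & \text{if } 0\le\alpha\le\alpha_1,\\[2mm] \dfrac{p^{\alpha_1+1}-1}{p-1}, & \text{if } \alpha_1\le\alpha\le\alpha_2,\\[2mm] \dfrac{p^{\alpha_1+\alpha_2-\alpha+1}-1}{p-1}, & \text{if } \alpha_2\le\alpha\le\alpha_1+\alpha_2.\end{cases}$$ In particular, the total number of subgroups of $\mathbb{Z}_{p^{\alpha_1}}\times\mathbb{Z}_{p^{\alpha_2}}$ is $$\frac{1}{(p-1)^2}\left[(\alpha_2-\alpha_1+1)p^{\alpha_1+2}-(\alpha_2-\alpha_1-1)p^{\alpha_1+1}-(\alpha_1+\alpha_2+3)p+(\alpha_1+\alpha_2+1)\right].$$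
   Context: $\mathbb{Z}_m$ denotes the cyclic group of order $m$. *)

theory Defs
  imports Complex_Main "HOL-Computational_Algebra.Primes" "HOL-Algebra.Elementary_Groups"
begin

end

theory Submission
  imports Defs
begin

text \<open>
  Subgroups of \<open>\<int>\<^sub>m \<times> \<int>\<^sub>n\<close> correspond to the sublattices of \<open>\<int>\<^sup>2\<close> that contain
  \<open>(m, 0)\<close> and \<open>(0, n)\<close>. Each such sublattice has a unique basis in Hermite normal form,
  \<open>(d, t)\<close> and \<open>(0, e)\<close> with \<open>d, e > 0\<close> and \<open>0 \<le> t < e\<close>; it contains \<open>(m, 0)\<close> and \<open>(0, n)\<close>
  exactly when \<open>d\<close> divides \<open>m\<close>, \<open>e\<close> divides \<open>n\<close>, and \<open>e\<close> divides \<open>c t\<close>, where \<open>c = m / d\<close>.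
  The subgroup so described has order \<open>c (n / e)\<close>, and for given \<open>c\<close> and \<open>e\<close> there are
  \<open>gcd c e\<close> admissible residues \<open>t\<close>. Hence the number of subgroups whose order has a given
  property is the sum of \<open>gcd c e\<close> over the divisors \<open>c\<close> of \<open>m\<close> and \<open>e\<close> of \<open>n\<close> for which
  \<open>c (n / e)\<close> has it (\<open>card_subgroups_DirProd_integer_mod_group\<close>).

  For \<open>m = p\<^sup>a\<close> and \<open>n = p\<^sup>b\<close>, put \<open>c = p\<^sup>k\<close> and \<open>e = p\<^sup>j\<close>. The summand is then
  \<open>p\<close> to the power \<open>min k j\<close>, and order \<open>p\<close> to the power \<open>a + b - s\<close> means \<open>k + s = a + j\<close>.
  Along this diagonal one of the two exponents is always the smaller, so the sum is a
  geometric one, with top exponent the least of \<open>s\<close>, \<open>a\<close> and \<open>a + b - s\<close>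
  when \<open>a \<le> b\<close> (\<open>sum_power_min_diagonal\<close>). The total number of subgroups is the
  sum over the whole rectangle \<open>k \<le> a\<close>, \<open>j \<le> b\<close>, evaluated by induction
  (\<open>sum_power_min_rectangle\<close>).
\<close>

section \<open>Sublattices of the integer plane\<close>

lemma subgroup_int_eq_multiples:
  fixes I :: "int set"
  assumes diff: "\<And>x y. x \<in> I \<Longrightarrow> y \<in> I \<Longrightarrow> x - y \<in> I"
    and m: "m \<in> I" "m > 0"
  obtains d where "d > 0" "I = {x. d dvd x}"
proof -
  have zero: "0 \<in> I" using diff[OF m(1) m(1)] by simp
  have neg: "- x \<in> I" if "x \<in> I" for x using diff[OF zero that] by simp
  have add: "x + y \<in> I" if "x \<in> I" "y \<in> I" for x y
    using diff[OF that(1) neg[OF that(2)]] by simp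
  have natmult: "int k * x \<in> I" if "x \<in> I" for x k
    by (induction k) (auto simp: zero algebra_simps intro: add that)
  have mult: "k * x \<in> I" if "x \<in> I" for x k
  proof (cases "k \<ge> 0")
    case True
    then show ?thesis using natmult[OF that, of "nat k"] by simp
  next
    case False
    then show ?thesis using neg[OF natmult[OF that, of "nat (- k)"]] by simp
  qed
  define d where "d = (LEAST k::nat. k > 0 \<and> int k \<in> I)"
  have ex: "nat m > 0 \<and> int (nat m) \<in> I" using m by simp
  have d: "d > 0" "int d \<in> I"
    using LeastI[of "\<lambda>k. k > 0 \<and> int k \<in> I", OF ex] by (auto simp: d_def)
  have "int d dvd x" if "x \<in> I" for x
  proof (rule ccontr)
    assume "\<not> int d dvd x"
    hence pos: "x mod int d > 0"
      using d(1) pos_mod_sign[of "int d" x] unfolding dvd_eq_mod_eq_0 by linarith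
    have "x mod int d = x - x div int d * int d" by (simp add: minus_div_mult_eq_mod)
    hence "x mod int d \<in> I" using diff[OF that mult[OF d(2)]] by metis
    hence "d \<le> nat (x mod int d)"
      using Least_le[of "\<lambda>k. k > 0 \<and> int k \<in> I", of "nat (x mod int d)"] pos
      by (simp add: d_def)
    moreover have "x mod int d < int d" using d(1) by simp
    ultimately show False using pos by linarith
  qed
  moreover have "x \<in> I" if "int d dvd x" for x
    using that mult[OF d(2)] by (metis dvdE mult.commute)
  ultimately have "I = {x. int d dvd x}" by blast
  thus ?thesis using that[of "int d"] d(1) by simp
qed

lemma card_residue_class_interval:
  fixes n e c :: int
  assumes "e > 0" "e dvd n" "n \<ge> 0"
  shows "card {y \<in> {0..<n}. e dvd y - c} = nat (n div e)"
proof -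
  have iff: "e dvd y - c \<longleftrightarrow> y mod e = c mod e" for y
    by (simp add: mod_eq_dvd_iff)
  have "bij_betw (\<lambda>l. e * l + c mod e) {0..<n div e} {y \<in> {0..<n}. e dvd y - c}"
  proof (rule bij_betwI[where g = "\<lambda>y. y div e"])
    show "(\<lambda>l. e * l + c mod e) \<in> {0..<n div e} \<rightarrow> {y \<in> {0..<n}. e dvd y - c}"
    proof
      fix l assume l: "l \<in> {0..<n div e}"
      have "e * (l + 1) \<le> e * (n div e)" using l assms by (intro mult_left_mono) auto
      hence "e * l + c mod e < n"
        using dvd_mult_div_cancel[OF assms(2)] pos_mod_bound[OF assms(1), of c]
        unfolding distrib_left by linarith
      moreover have "e * l + c mod e \<ge> 0" using l assms by simp
      ultimately show "e * l + c mod e \<in> {y \<in> {0..<n}. e dvd y - c}" by (simp add: iff)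
    qed
    show "(\<lambda>y. y div e) \<in> {y \<in> {0..<n}. e dvd y - c} \<rightarrow> {0..<n div e}"
    proof
      fix y assume y: "y \<in> {y \<in> {0..<n}. e dvd y - c}"
      obtain q where q: "n = e * q" using assms(2) by blast
      have "y < q * e" using y q by (simp add: mult.commute)
      moreover have "y div e * e \<le> y"
        using div_mult_mod_eq[of y e] pos_mod_sign[OF assms(1), of y]
        by linarith
      ultimately have "y div e * e < q * e" by linarith
      hence "y div e < q" using assms(1) by simp
      thus "y div e \<in> {0..<n div e}" using y assms q by (auto simp: pos_imp_zdiv_nonneg_iff)
    qed
    show "(e * l + c mod e) div e = l" for l using assms(1) by simp
    show "e * (y div e) + c mod e = y" if "y \<in> {y \<in> {0..<n}. e dvd y - c}" for y
      using that iff[of y] mult_div_mod_eq[of e y] by simp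
  qed
  from bij_betw_same_card[OF this] show ?thesis by simp
qed

text \<open>
  The lattice spanned by \<open>(d, t)\<close> and \<open>(0, e)\<close>, for \<open>d \<noteq> 0\<close>, described by congruences:
  \<open>(x, y)\<close> lies in it iff \<open>x = k d\<close> for some integer \<open>k\<close> and \<open>y - k t\<close> is a multiple of \<open>e\<close>.
\<close>

definition hermite_lattice :: "int \<Rightarrow> int \<Rightarrow> int \<Rightarrow> (int \<times> int) set" where
  "hermite_lattice d e t = {(x, y). d dvd x \<and> e dvd y - x div d * t}"

lemma hermite_lattice_diff:
  assumes "d > 0" "(x, y) \<in> hermite_lattice d e t" "(x', y') \<in> hermite_lattice d e t"
  shows "(x - x', y - y') \<in> hermite_lattice d e t"
proof -
  obtain u v where uv: "x = d * u" "x' = d * v" "e dvd y - u * t" "e dvd y' - v * t"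
    using assms unfolding hermite_lattice_def by fastforce
  have "x - x' = d * (u - v)" by (simp add: uv algebra_simps)
  hence x: "d dvd x - x'" "(x - x') div d = u - v" using assms(1) by auto
  have "(y - y') - (u - v) * t = (y - u * t) - (y' - v * t)"
    by (simp add: algebra_simps)
  hence "e dvd (y - y') - (u - v) * t" using uv by (metis dvd_diff)
  thus ?thesis using x unfolding hermite_lattice_def by simp
qed

lemma hermite_lattice_inj:
  assumes eq: "hermite_lattice d e t = hermite_lattice d' e' t'"
    and pos: "d > 0" "e > 0" "d' > 0" "e' > 0"
    and t: "t \<in> {0..<e}" "t' \<in> {0..<e'}"
  shows "d = d' \<and> e = e' \<and> t = t'"
proof -
  have gen: "(d, t) \<in> hermite_lattice d e t" "(0, e) \<in> hermite_lattice d e t" if "d > 0"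
    for d e t :: int using that by (auto simp: hermite_lattice_def)
  have "(d, t) \<in> hermite_lattice d' e' t'" "(0, e) \<in> hermite_lattice d' e' t'"
       "(d', t') \<in> hermite_lattice d e t" "(0, e') \<in> hermite_lattice d e t"
    using gen pos eq by metis+
  hence "d' dvd d" "d dvd d'" "e' dvd e" "e dvd e'" and tt: "e dvd t' - d' div d * t"
    by (auto simp: hermite_lattice_def)
  hence de: "d = d'" "e = e'" using pos by (auto intro: zdvd_antisym_nonneg)
  have "e dvd t' - t" using tt de pos by simp
  hence "t' mod e = t mod e" by (simp add: mod_eq_dvd_iff)
  thus ?thesis using t de by simp
qed

lemma sublattice_eq_hermite_lattice:
  fixes L :: "(int \<times> int) set"
  assumes diff: "\<And>x y x' y'. (x, y) \<in> L \<Longrightarrow> (x', y') \<in> L \<Longrightarrow> (x - x', y - y') \<in> L"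
    and m: "(m, 0) \<in> L" "m > 0" and n: "(0, n) \<in> L" "n > 0"
  obtains d e t where "d > 0" "e > 0" "t \<in> {0..<e}" "L = hermite_lattice d e t"
proof -
  have "x - x' \<in> fst ` L" if "x \<in> fst ` L" "x' \<in> fst ` L" for x x'
    using that diff by force
  moreover have "m \<in> fst ` L" using m by force
  ultimately obtain d where d: "d > 0" "fst ` L = {x. d dvd x}"
    using subgroup_int_eq_multiples[of "fst ` L" m] m by metis
  have "x - x' \<in> {y. (0, y) \<in> L}" if "x \<in> {y. (0, y) \<in> L}" "x' \<in> {y. (0, y) \<in> L}" for x x'
    using that diff[of 0 x 0 x'] by simp
  then obtain e where e: "e > 0" "{y. (0, y) \<in> L} = {y. e dvd y}"
    using subgroup_int_eq_multiples[of "{y. (0, y) \<in> L}" n] n by auto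
  have e_iff: "(0, y) \<in> L \<longleftrightarrow> e dvd y" for y using e(2) by blast
  have zero: "(0, 0) \<in> L" by (simp add: e_iff)
  have neg: "(- x, - y) \<in> L" if "(x, y) \<in> L" for x y using diff[OF zero that] by simp
  have add: "(x + x', y + y') \<in> L" if "(x, y) \<in> L" "(x', y') \<in> L" for x x' y y'
    using diff[OF that(1) neg[OF that(2)]] by simp
  \<comment> \<open>Any point of \<open>L\<close> above \<open>d\<close> may be shifted by multiples of \<open>(0, e)\<close>, so that its second
    coordinate becomes the least residue modulo \<open>e\<close>.\<close>
  obtain s where s: "(d, s) \<in> L"
  proof -
    have "d \<in> fst ` L" by (simp add: d(2))
    thus thesis using that by auto
  qed
  define t where "t = s mod e"
  have "(0, s - t) \<in> L" by (simp add: e_iff t_def minus_mod_eq_mult_div)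
  hence dt: "(d, t) \<in> L" using diff[OF s, of 0 "s - t"] by simp
  have nmult: "(int k * d, int k * t) \<in> L" for k
    by (induction k) (use zero dt add in \<open>auto simp: algebra_simps\<close>)
  have mult: "(k * d, k * t) \<in> L" for k
  proof (cases "k \<ge> 0")
    case True
    then show ?thesis using nmult[of "nat k"] by simp
  next
    case False
    then show ?thesis using neg[OF nmult[of "nat (- k)"]] by simp
  qed
  have "(x, y) \<in> L \<longleftrightarrow> (x, y) \<in> hermite_lattice d e t" for x y
  proof (cases "d dvd x")
    case True
    then obtain k where k: "x = k * d" by (metis dvd_def mult.commute)
    have "(x, y) \<in> L \<longleftrightarrow> (0, y - k * t) \<in> L"
      using diff[OF _ mult[of k], of x y] add[OF _ mult[of k], of 0 "y - k * t"] k by auto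
    thus ?thesis using k d(1) by (auto simp: e_iff hermite_lattice_def)
  next
    case False
    hence "x \<notin> fst ` L" using d(2) by blast
    hence "(x, y) \<notin> L" by force
    thus ?thesis using False by (simp add: hermite_lattice_def)
  qed
  hence "L = hermite_lattice d e t" by auto
  moreover have "t \<in> {0..<e}" using e(1) by (simp add: t_def)
  ultimately show ?thesis using that d(1) e(1) by blast
qed

text \<open>
  The divisibility conditions say that the lattice contains \<open>(m, 0)\<close> and \<open>(0, n)\<close>; for
  positive \<open>m\<close> and \<open>n\<close> it is then determined by its points in the box \<open>[0, m) \<times> [0, n)\<close>.
\<close>

lemma hermite_lattice_mod_iff:
  assumes "d > 0" "d dvd m" "e dvd n" "e dvd m div d * t"
  shows "(x mod m, y mod n) \<in> hermite_lattice d e t \<longleftrightarrow> (x, y) \<in> hermite_lattice d e t"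
proof (cases "d dvd x")
  case True
  obtain u where u: "m = d * u" using assms(2) by blast
  obtain k where k: "x = d * k" using True by blast
  have "x mod m = d * (k - u * (x div m))"
    using mult_div_mod_eq[of m x] by (simp add: u k algebra_simps)
  hence xm: "d dvd x mod m" "x mod m div d = k - u * (x div m)" using assms(1) by auto
  have "y mod n - (k - u * (x div m)) * t = (y - k * t) + ((x div m) * (u * t) - n * (y div n))"
    using mult_div_mod_eq[of n y] by (simp add: algebra_simps)
  moreover have "e dvd (x div m) * (u * t) - n * (y div n)"
    using assms u by (intro dvd_diff) auto
  ultimately have "e dvd y mod n - (k - u * (x div m)) * t \<longleftrightarrow> e dvd y - k * t"
    by (metis dvd_add_left_iff)
  thus ?thesis using xm k assms(1) by (simp add: hermite_lattice_def)
next
  case False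
  hence "\<not> d dvd x mod m" using assms(2) by (simp add: dvd_mod_iff)
  thus ?thesis using False by (simp add: hermite_lattice_def)
qed

lemma card_hermite_lattice_box:
  assumes "d > 0" "e > 0" "d dvd m" "e dvd n" "m \<ge> 0" "n \<ge> 0"
  shows "card (hermite_lattice d e t \<inter> {0..<m} \<times> {0..<n}) = nat (m div d) * nat (n div e)"
proof -
  \<comment> \<open>The multiples of \<open>d\<close> are written as the residue class of \<open>0\<close>, so that the count of a
    residue class serves for both coordinates.\<close>
  let ?A = "{x \<in> {0..<m}. d dvd x - 0}"
  let ?B = "\<lambda>x. {y \<in> {0..<n}. e dvd y - x div d * t}"
  have finA: "finite ?A" by (rule finite_subset[of _ "{0..<m}"]) auto
  have finB: "\<forall>x\<in>?A. finite (?B x)"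
    by (intro ballI, rule finite_subset[of _ "{0..<n}"]) auto
  have "hermite_lattice d e t \<inter> {0..<m} \<times> {0..<n} = Sigma ?A ?B"
    by (auto simp: hermite_lattice_def)
  moreover have "card (Sigma ?A ?B) = (\<Sum>x\<in>?A. card (?B x))"
    by (rule card_SigmaI[OF finA finB])
  moreover have "(\<Sum>x\<in>?A. card (?B x)) = (\<Sum>x\<in>?A. nat (n div e))"
    by (intro sum.cong refl card_residue_class_interval assms)
  moreover have "(\<Sum>x\<in>?A. nat (n div e)) = nat (m div d) * nat (n div e)"
    using card_residue_class_interval[OF assms(1,3,5), of 0] by (simp only: sum_constant of_nat_id)
  ultimately show ?thesis by metis
qed

section \<open>Subgroups of a product of two cyclic groups\<close>

lemma subgroup_hermite_lattice_box:
  fixes m n :: nat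
  assumes "m > 0" "n > 0" and d: "d > 0" "d dvd int m" "e dvd int n" "e dvd int m div d * t"
  shows "subgroup (hermite_lattice d e t \<inter> {0..<int m} \<times> {0..<int n})
           (integer_mod_group m \<times>\<times> integer_mod_group n)" (is "subgroup ?H ?G")
proof -
  interpret group ?G by (simp add: DirProd_group)
  have red: "(x mod int m, y mod int n) \<in> ?H \<longleftrightarrow> (x, y) \<in> hermite_lattice d e t" for x y
    using hermite_lattice_mod_iff[OF d] assms(1,2) by simp
  have zero: "(0, 0) \<in> hermite_lattice d e t" by (simp add: hermite_lattice_def)
  have neg: "(- x, - y) \<in> hermite_lattice d e t" if "(x, y) \<in> hermite_lattice d e t" for x y
    using hermite_lattice_diff[OF d(1) zero that] by simp
  show ?thesis
  proof (rule subgroupI)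
    show "?H \<subseteq> carrier ?G" using assms(1,2) by (auto simp: carrier_integer_mod_group)
    show "?H \<noteq> {}" using zero assms(1,2) by force
  next
    fix g assume g: "g \<in> ?H"
    obtain x y where xy: "g = (x, y)" by (cases g)
    have "inv\<^bsub>?G\<^esub> g = (- x mod int m, - y mod int n)"
      using g xy assms(1,2) by (simp add: inv_DirProd carrier_integer_mod_group)
    thus "inv\<^bsub>?G\<^esub> g \<in> ?H" using red neg g xy by simp
  next
    fix g h assume g: "g \<in> ?H" "h \<in> ?H"
    obtain x y x' y' where xy: "g = (x, y)" "h = (x', y')" by (cases g, cases h)
    have "(x + x', y + y') \<in> hermite_lattice d e t"
      using hermite_lattice_diff[OF d(1) _ neg, of x y x' y'] g xy by simp
    thus "g \<otimes>\<^bsub>?G\<^esub> h \<in> ?H" using red xy by simp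
  qed
qed

lemma subgroup_eq_hermite_lattice_box:
  fixes m n :: nat
  assumes "m > 0" "n > 0" and H: "subgroup H (integer_mod_group m \<times>\<times> integer_mod_group n)"
  obtains d e t where "d > 0" "e > 0" "t \<in> {0..<e}"
    "d dvd int m" "e dvd int n" "e dvd int m div d * t"
    "H = hermite_lattice d e t \<inter> {0..<int m} \<times> {0..<int n}"
proof -
  let ?G = "integer_mod_group m \<times>\<times> integer_mod_group n"
  interpret group ?G by (simp add: DirProd_group)
  interpret H: subgroup H ?G by (rule H)
  \<comment> \<open>the preimage of \<open>H\<close> under reduction of both coordinates\<close>
  define L where "L = {(x, y). (x mod int m, y mod int n) \<in> H}"
  have sub: "H \<subseteq> {0..<int m} \<times> {0..<int n}"
    using H.subset assms(1,2) by (simp add: carrier_integer_mod_group)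
  have zero: "(0, 0) \<in> H" using H.one_closed by simp
  have diff: "(x - x', y - y') \<in> L" if "(x, y) \<in> L" "(x', y') \<in> L" for x y x' y'
  proof -
    let ?g = "(x mod int m, y mod int n)" and ?h = "(x' mod int m, y' mod int n)"
    have "inv\<^bsub>?G\<^esub> ?h = (- x' mod int m, - y' mod int n)"
      using assms(1,2) by (simp add: inv_DirProd carrier_integer_mod_group mod_minus_eq)
    hence "?g \<otimes>\<^bsub>?G\<^esub> inv\<^bsub>?G\<^esub> ?h = ((x - x') mod int m, (y - y') mod int n)"
      by (simp add: mod_add_eq)
    moreover have "?g \<otimes>\<^bsub>?G\<^esub> inv\<^bsub>?G\<^esub> ?h \<in> H" using that by (auto simp: L_def)
    ultimately show ?thesis by (simp add: L_def)
  qed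
  have mem: "(int m, 0) \<in> L" "(0, int n) \<in> L" using zero by (auto simp: L_def)
  obtain d e t where det: "d > 0" "e > 0" "t \<in> {0..<e}" "L = hermite_lattice d e t"
    using sublattice_eq_hermite_lattice[of L "int m" "int n"] diff mem assms(1,2) by auto
  have "H = L \<inter> {0..<int m} \<times> {0..<int n}"
    using sub by (auto simp: L_def)
  moreover have "d dvd int m" "e dvd int n" "e dvd int m div d * t"
    using mem unfolding det(4) by (auto simp: hermite_lattice_def)
  ultimately show ?thesis using that det by blast
qed

text \<open>
  With \<open>g = gcd c e\<close>, the condition \<open>e dvd c t\<close> says that \<open>t\<close> is a multiple of \<open>e / g\<close>,
  and there are \<open>g\<close> of these below \<open>e\<close>.
\<close>

lemma card_annihilated_residues:
  fixes c e :: nat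
  assumes "e > 0"
  shows "card {t \<in> {0..<int e}. int e dvd int c * t} = gcd c e"
proof -
  have "int e dvd int c * t \<longleftrightarrow> int (e div gcd c e) dvd t - 0" for t
  proof -
    have g: "gcd c e > 0" using assms by simp
    have ce: "int e = int (gcd c e) * int (e div gcd c e)"
      "int c = int (gcd c e) * int (c div gcd c e)"
      by (simp_all flip: of_nat_mult)
    have "int e dvd int c * t \<longleftrightarrow>
        int (gcd c e) * int (e div gcd c e) dvd int (gcd c e) * (int (c div gcd c e) * t)"
      by (subst ce(1), subst ce(2)) (simp only: mult.assoc)
    also have "\<dots> \<longleftrightarrow> int (e div gcd c e) dvd int (c div gcd c e) * t"
      using g by (subst dvd_mult_cancel_left) (simp only: of_nat_eq_0_iff, linarith)
    also have "\<dots> \<longleftrightarrow> int (e div gcd c e) dvd t"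
    proof -
      have "coprime (c div gcd c e) (e div gcd c e)"
        using assms by (intro div_gcd_coprime) auto
      hence "coprime (int (e div gcd c e)) (int (c div gcd c e))"
        by (simp add: coprime_commute)
      thus ?thesis by (rule coprime_dvd_mult_right_iff)
    qed
    finally show ?thesis by simp
  qed
  moreover have "card {t \<in> {0..<int e}. int (e div gcd c e) dvd t - 0}
      = nat (int e div int (e div gcd c e))"
  proof (rule card_residue_class_interval)
    show "0 < int (e div gcd c e)" using assms by (simp add: div_greater_zero_iff gcd_le2_nat)
    have "e div gcd c e dvd e" by (metis dvd_def dvd_div_mult_self gcd_dvd2)
    thus "int (e div gcd c e) dvd int e" by simp
  qed simp
  moreover have "e div (e div gcd c e) = gcd c e"
    using assms by (simp add: div_div_eq_right)
  ultimately show ?thesis by (simp flip: of_nat_div)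
qed

text \<open>
  The divisor \<open>c\<close> is the order of the projection of the subgroup to the first factor, and
  \<open>n div e\<close> the order of its intersection with the second factor. The property \<open>Q\<close> of the order
  is left open so that both the subgroups of a given order and all subgroups are covered.
\<close>

theorem card_subgroups_DirProd_integer_mod_group:
  fixes m n :: nat
  assumes "m > 0" "n > 0"
  shows "card {H. subgroup H (integer_mod_group m \<times>\<times> integer_mod_group n) \<and> Q (card H)} =
         (\<Sum>(c, e) | c dvd m \<and> e dvd n \<and> Q (c * (n div e)). gcd c e)"
proof -
  let ?box = "{0..<int m} \<times> {0..<int n}"
  let ?G = "integer_mod_group m \<times>\<times> integer_mod_group n"
  define P where "P = {(c, e). c dvd m \<and> e dvd n \<and> Q (c * (n div e))}"
  define T where "T = (\<lambda>(c::nat, e::nat). {t \<in> {0..<int e}. int e dvd int c * t})"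
  define f where "f = (\<lambda>((c::nat, e::nat), t). hermite_lattice (int (m div c)) (int e) t \<inter> ?box)"
  \<comment> \<open>The lattice attached to \<open>(c, e, t)\<close> has \<open>d = m div c\<close>.\<close>
  have par: "int (m div c) > 0" "int (m div c) dvd int m" "int m div int (m div c) = int c" "e > 0"
    if c: "c dvd m" and e: "e dvd n" for c e
  proof -
    obtain k where k: "m = c * k" using c by blast
    thus "int (m div c) > 0" "int (m div c) dvd int m" "int m div int (m div c) = int c"
      using assms(1) by auto
    show "e > 0" using e assms(2) by (auto intro: Nat.gr0I)
  qed
  have card_f: "card (f ((c, e), t)) = c * (n div e)" if "c dvd m" "e dvd n" for c e t
    unfolding f_def prod.case
    by (subst card_hermite_lattice_box)
      (use par[OF that] that in \<open>auto simp flip: of_nat_div\<close>)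
  have "inj_on f (Sigma P T)"
  proof (rule inj_onI, clarsimp simp: P_def T_def)
    fix c e t c' e' t'
    assume ce: "c dvd m" "e dvd n" "c' dvd m" "e' dvd n"
      and t: "0 \<le> t" "t < int e" "int e dvd int c * t"
      and t': "0 \<le> t'" "t' < int e'" "int e' dvd int c' * t'"
      and eq: "f ((c, e), t) = f ((c', e'), t')"
    note p = par[OF ce(1,2)] and p' = par[OF ce(3,4)]
    have "(x, y) \<in> hermite_lattice (int (m div c)) (int e) t \<longleftrightarrow>
          (x, y) \<in> hermite_lattice (int (m div c')) (int e') t'" for x y
    proof -
      have "(x, y) \<in> hermite_lattice (int (m div c)) (int e) t \<longleftrightarrow>
            (x mod int m, y mod int n) \<in> f ((c, e), t)"
        using hermite_lattice_mod_iff[OF p(1,2), of "int e" "int n" t x y] ce t p(3) assms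
        by (simp add: f_def)
      moreover have "(x, y) \<in> hermite_lattice (int (m div c')) (int e') t' \<longleftrightarrow>
            (x mod int m, y mod int n) \<in> f ((c', e'), t')"
        using hermite_lattice_mod_iff[OF p'(1,2), of "int e'" "int n" t' x y] ce t' p'(3) assms
        by (simp add: f_def)
      ultimately show ?thesis using eq by simp
    qed
    hence "hermite_lattice (int (m div c)) (int e) t = hermite_lattice (int (m div c')) (int e') t'"
      by auto
    from hermite_lattice_inj[OF this p(1) _ p'(1)] have eqs: "int (m div c) = int (m div c')"
      "int e = int e'" "t = t'"
      using p(4) p'(4) t(1,2) t'(1,2) unfolding of_nat_0_less_iff atLeastLessThan_iff by blast+
    moreover have "int c = int c'" using p(3) p'(3) eqs(1) by metis
    ultimately show "c = c' \<and> e = e' \<and> t = t'" by simp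
  qed
  moreover have "f ` Sigma P T = {H. subgroup H ?G \<and> Q (card H)}"
  proof (intro subset_antisym subsetI)
    fix H assume "H \<in> f ` Sigma P T"
    then obtain c e t where H: "H = f ((c, e), t)"
      and ce: "c dvd m" "e dvd n" "Q (c * (n div e))" and t: "int e dvd int c * t"
      by (auto simp: P_def T_def)
    have "subgroup H ?G"
      using subgroup_hermite_lattice_box[OF assms par(1,2)[OF ce(1,2)], of "int e" t]
        par(3)[OF ce(1,2)] ce(2) t by (simp add: H f_def)
    thus "H \<in> {H. subgroup H ?G \<and> Q (card H)}"
      using card_f[OF ce(1,2)] ce(3) by (simp add: H)
  next
    fix H assume "H \<in> {H. subgroup H ?G \<and> Q (card H)}"
    hence H: "subgroup H ?G" and Q: "Q (card H)" by auto
    obtain d e t where det: "d > 0" "e > 0" "t \<in> {0..<e}"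
      "d dvd int m" "e dvd int n" "e dvd int m div d * t" "H = hermite_lattice d e t \<inter> ?box"
      using subgroup_eq_hermite_lattice_box[OF assms H] by metis
    define c e' where "c = m div nat d" and "e' = nat e"
    have de: "d = int (nat d)" "e = int e'" using det by (auto simp: e'_def)
    have dm: "nat d dvd m" using det(1,4) by (simp add: nat_dvd_iff)
    then obtain k where k: "m = nat d * k" by blast
    have c: "c dvd m" "nat d = m div c" "int m div d = int c"
      using k assms(1) det(1) de(1) by (auto simp: c_def)
    have e': "e' dvd n" using det(2,5) by (simp add: e'_def nat_dvd_iff)
    have Hf: "H = f ((c, e'), t)" unfolding f_def using det(7) de c(2) by simp
    have "((c, e'), t) \<in> Sigma P T"
      using c e' det(3,6) Q card_f[OF c(1) e'] Hf de(2) by (simp add: P_def T_def)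
    thus "H \<in> f ` Sigma P T" using Hf by blast
  qed
  ultimately have "card {H. subgroup H ?G \<and> Q (card H)} = card (Sigma P T)"
    using card_image by metis
  also have "\<dots> = (\<Sum>x\<in>P. card (T x))"
  proof (rule card_SigmaI)
    have "P \<subseteq> {..m} \<times> {..n}" using assms by (auto simp: P_def dvd_imp_le)
    thus "finite P" by (rule finite_subset) simp
    show "\<forall>x\<in>P. finite (T x)"
      by (auto simp: T_def intro: finite_subset[of _ "{0..<int _}"])
  qed
  also have "\<dots> = (\<Sum>(c, e)\<in>P. gcd c e)"
    using card_annihilated_residues par(4) by (intro sum.cong) (auto simp only: P_def T_def)
  finally show ?thesis by (simp add: P_def)
qed

section \<open>Prime powers\<close>

lemma card_subgroups_DirProd_prime_power:
  fixes p a b :: nat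
  assumes "Factorial_Ring.prime p"
  shows "card {H. subgroup H (integer_mod_group (p ^ a) \<times>\<times> integer_mod_group (p ^ b))
                  \<and> Q (card H)} =
         (\<Sum>(k, j) | k \<le> a \<and> j \<le> b \<and> Q (p ^ (k + (b - j))). p ^ min k j)"
proof -
  have p: "p > 1" using assms by (rule prime_gt_1_nat)
  let ?S = "{(k, j). k \<le> a \<and> j \<le> b \<and> Q (p ^ (k + (b - j)))}"
  let ?T = "{(c, e). c dvd p ^ a \<and> e dvd p ^ b \<and> Q (c * (p ^ b div e))}"
  let ?f = "\<lambda>(k, j). (p ^ k, p ^ j)"
  have order: "p ^ k * (p ^ b div p ^ j) = p ^ (k + (b - j))" if "j \<le> b" for k j
  proof -
    have "p ^ b div p ^ j = p ^ (b - j)" using that p by (simp add: power_diff)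
    thus ?thesis by (simp only: power_add)
  qed
  have "inj_on ?f ?S" using p by (auto simp: inj_on_def)
  moreover have "?f ` ?S = ?T"
    using order by (fastforce simp: divides_primepow_nat[OF assms])
  ultimately have "bij_betw ?f ?S ?T" by (simp add: bij_betw_def)
  hence "(\<Sum>x\<in>?S. case ?f x of (c, e) \<Rightarrow> gcd c e) = (\<Sum>(c, e)\<in>?T. gcd c e)"
    by (rule sum.reindex_bij_betw)
  moreover have "gcd (p ^ k) (p ^ j) = p ^ min k j" for k j
    by (cases "k \<le> j") (auto simp: min_def gcd_proj1_if_dvd gcd_proj2_if_dvd le_imp_power_dvd)
  ultimately have "(\<Sum>(k, j)\<in>?S. p ^ min k j) = (\<Sum>(c, e)\<in>?T. gcd c e)"
    by (simp add: case_prod_unfold)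
  thus ?thesis
    using card_subgroups_DirProd_integer_mod_group[of "p ^ a" "p ^ b" Q] p by simp
qed

text \<open>
  Passing from \<open>a\<close> to \<open>a + 1\<close> adds the terms with \<open>k = a + 1\<close> or \<open>j = a + 1\<close>: two geometric sums
  and the corner \<open>x ^ (a + 1)\<close>. Both sides are multiplied by \<open>(x - 1)\<^sup>2\<close>, so that \<open>x = 1\<close> need not
  be excluded.
\<close>

lemma sum_power_min_square:
  fixes x :: real
  shows "(x - 1)\<^sup>2 * (\<Sum>k\<le>a. \<Sum>j\<le>a. x ^ min k j)
         = x ^ (a + 2) + x ^ (a + 1) - (2 * real a + 3) * x + (2 * real a + 1)"
proof (induction a)
  case 0
  show ?case by (simp add: power2_eq_square algebra_simps)
next
  case (Suc a)
  have geo: "(x - 1) * (\<Sum>k\<le>a. x ^ k) = x ^ (a + 1) - 1"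
    using power_diff_1_eq[of x "Suc a"] by (simp add: lessThan_Suc_atMost)
  have "(\<Sum>k\<le>Suc a. \<Sum>j\<le>Suc a. x ^ min k j)
        = (\<Sum>k\<le>a. \<Sum>j\<le>a. x ^ min k j) + 2 * (\<Sum>k\<le>a. x ^ k) + x ^ (a + 1)"
    by (simp add: sum.distrib min_def)
  hence "(x - 1)\<^sup>2 * (\<Sum>k\<le>Suc a. \<Sum>j\<le>Suc a. x ^ min k j)
        = (x - 1)\<^sup>2 * (\<Sum>k\<le>a. \<Sum>j\<le>a. x ^ min k j)
          + 2 * (x - 1) * ((x - 1) * (\<Sum>k\<le>a. x ^ k)) + (x - 1)\<^sup>2 * x ^ (a + 1)"
    by (simp add: power2_eq_square algebra_simps)
  also have "\<dots> = x ^ (Suc a + 2) + x ^ (Suc a + 1) - (2 * real (Suc a) + 3) * x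
                  + (2 * real (Suc a) + 1)"
    unfolding Suc.IH geo by (simp add: power2_eq_square algebra_simps)
  finally show ?case .
qed

lemma sum_power_min_rectangle:
  fixes x :: real
  assumes "a \<le> b"
  shows "(x - 1)\<^sup>2 * (\<Sum>k\<le>a. \<Sum>j\<le>b. x ^ min k j)
         = (real b - real a + 1) * x ^ (a + 2) - (real b - real a - 1) * x ^ (a + 1)
           - (real a + real b + 3) * x + (real a + real b + 1)"
  using assms
proof (induction b rule: dec_induct)
  case base
  show ?case by (simp add: sum_power_min_square algebra_simps)
next
  case (step b)
  have geo: "(x - 1) * (\<Sum>k\<le>a. x ^ k) = x ^ (a + 1) - 1"
    using power_diff_1_eq[of x "Suc a"] by (simp add: lessThan_Suc_atMost)
  have "(\<Sum>k\<le>a. \<Sum>j\<le>Suc b. x ^ min k j) = (\<Sum>k\<le>a. \<Sum>j\<le>b. x ^ min k j) + (\<Sum>k\<le>a. x ^ k)"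
    using step.hyps by (simp add: sum.distrib min_def)
  hence "(x - 1)\<^sup>2 * (\<Sum>k\<le>a. \<Sum>j\<le>Suc b. x ^ min k j)
         = (x - 1)\<^sup>2 * (\<Sum>k\<le>a. \<Sum>j\<le>b. x ^ min k j) + (x - 1) * ((x - 1) * (\<Sum>k\<le>a. x ^ k))"
    by (simp add: power2_eq_square algebra_simps)
  also have "\<dots> = (real (Suc b) - real a + 1) * x ^ (a + 2)
       - (real (Suc b) - real a - 1) * x ^ (a + 1)
       - (real a + real (Suc b) + 3) * x + (real a + real (Suc b) + 1)"
    unfolding step.IH geo by (simp add: power2_eq_square algebra_simps)
  finally show ?case .
qed

text \<open>
  On the line \<open>k + s = a + j\<close> the minimum is \<open>j\<close> throughout if \<open>s \<le> a\<close>, and \<open>k\<close> throughout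
  if \<open>s \<ge> a\<close>.
\<close>

lemma sum_power_min_diagonal:
  fixes p a b s :: nat
  assumes "a \<le> b" "s \<le> a + b"
  shows "(\<Sum>(k, j) | k \<le> a \<and> j \<le> b \<and> k + s = a + j. p ^ min k j)
         = (\<Sum>i\<le>min s (min a (a + b - s)). p ^ i)"
proof (cases "s \<le> a")
  case True
  have "bij_betw (\<lambda>j. (a - s + j, j)) {..s} {(k, j). k \<le> a \<and> j \<le> b \<and> k + s = a + j}"
    using True assms by (intro bij_betwI[where g = snd]) auto
  from sum.reindex_bij_betw[OF this, of "\<lambda>(k, j). p ^ min k j"]
  have "(\<Sum>(k, j) | k \<le> a \<and> j \<le> b \<and> k + s = a + j. p ^ min k j)
        = (\<Sum>j\<le>s. p ^ min (a - s + j) j)" by simp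
  also have "\<dots> = (\<Sum>i\<le>min s (min a (a + b - s)). p ^ i)"
  proof (rule sum.cong)
    show "{..s} = {..min s (min a (a + b - s))}" using True assms by auto
    show "p ^ min (a - s + j) j = p ^ j" for j by (simp add: min_absorb2)
  qed
  finally show ?thesis .
next
  case False
  have "bij_betw (\<lambda>k. (k, k + s - a)) {..min a (a + b - s)}
          {(k, j). k \<le> a \<and> j \<le> b \<and> k + s = a + j}"
    using False assms by (intro bij_betwI[where g = fst]) auto
  from sum.reindex_bij_betw[OF this, of "\<lambda>(k, j). p ^ min k j"]
  have "(\<Sum>(k, j) | k \<le> a \<and> j \<le> b \<and> k + s = a + j. p ^ min k j)
        = (\<Sum>k\<le>min a (a + b - s). p ^ min k (k + s - a))" by simp
  also have "\<dots> = (\<Sum>i\<le>min s (min a (a + b - s)). p ^ i)"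
    using False by (intro sum.cong) (auto simp: min_def)
  finally show ?thesis .
qed

theorem theorem3p3:
  fixes p \<alpha>\<^sub>1 \<alpha>\<^sub>2 :: nat
  assumes "Factorial_Ring.prime p" and "1 \<le> \<alpha>\<^sub>1" and "\<alpha>\<^sub>1 \<le> \<alpha>\<^sub>2"
  shows
    "(\<forall>\<alpha>::nat. \<alpha> \<le> \<alpha>\<^sub>1 + \<alpha>\<^sub>2 \<longrightarrow>
        (let N = real (card {H. subgroup H (integer_mod_group (p ^ \<alpha>\<^sub>1) \<times>\<times> integer_mod_group (p ^ \<alpha>\<^sub>2))
                             \<and> card H = p ^ (\<alpha>\<^sub>1 + \<alpha>\<^sub>2 - \<alpha>)}) in
          (\<alpha> \<le> \<alpha>\<^sub>1 \<longrightarrow> N = (real p ^ (\<alpha> + 1) - 1) / (real p - 1)) \<and>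
          (\<alpha>\<^sub>1 \<le> \<alpha> \<and> \<alpha> \<le> \<alpha>\<^sub>2 \<longrightarrow> N = (real p ^ (\<alpha>\<^sub>1 + 1) - 1) / (real p - 1)) \<and>
          (\<alpha>\<^sub>2 \<le> \<alpha> \<longrightarrow> N = (real p ^ (\<alpha>\<^sub>1 + \<alpha>\<^sub>2 - \<alpha> + 1) - 1) / (real p - 1))))
     \<and> real (card {H. subgroup H (integer_mod_group (p ^ \<alpha>\<^sub>1) \<times>\<times> integer_mod_group (p ^ \<alpha>\<^sub>2))})
        = 1 / (real p - 1)\<^sup>2 *
          ((real \<alpha>\<^sub>2 - real \<alpha>\<^sub>1 + 1) * real p ^ (\<alpha>\<^sub>1 + 2)
           - (real \<alpha>\<^sub>2 - real \<alpha>\<^sub>1 - 1) * real p ^ (\<alpha>\<^sub>1 + 1)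
           - (real \<alpha>\<^sub>1 + real \<alpha>\<^sub>2 + 3) * real p
           + (real \<alpha>\<^sub>1 + real \<alpha>\<^sub>2 + 1))"
proof -
  let ?G = "integer_mod_group (p ^ \<alpha>\<^sub>1) \<times>\<times> integer_mod_group (p ^ \<alpha>\<^sub>2)"
  have p: "p > 1" using assms(1) by (rule prime_gt_1_nat)
  have geo: "real (\<Sum>i\<le>n. p ^ i) = (real p ^ (n + 1) - 1) / (real p - 1)" for n
    using power_diff_1_eq[of "real p" "Suc n"] p by (simp add: lessThan_Suc_atMost)
  have N: "real (card {H. subgroup H ?G \<and> card H = p ^ (\<alpha>\<^sub>1 + \<alpha>\<^sub>2 - \<alpha>)})
           = (real p ^ (min \<alpha> (min \<alpha>\<^sub>1 (\<alpha>\<^sub>1 + \<alpha>\<^sub>2 - \<alpha>)) + 1) - 1) / (real p - 1)"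
    if \<alpha>: "\<alpha> \<le> \<alpha>\<^sub>1 + \<alpha>\<^sub>2" for \<alpha>
  proof -
    have "p ^ (k + (\<alpha>\<^sub>2 - j)) = p ^ (\<alpha>\<^sub>1 + \<alpha>\<^sub>2 - \<alpha>) \<longleftrightarrow> k + \<alpha> = \<alpha>\<^sub>1 + j" if "j \<le> \<alpha>\<^sub>2" for k j
      using p that \<alpha> by auto
    hence "{(k, j). k \<le> \<alpha>\<^sub>1 \<and> j \<le> \<alpha>\<^sub>2 \<and> p ^ (k + (\<alpha>\<^sub>2 - j)) = p ^ (\<alpha>\<^sub>1 + \<alpha>\<^sub>2 - \<alpha>)}
          = {(k, j). k \<le> \<alpha>\<^sub>1 \<and> j \<le> \<alpha>\<^sub>2 \<and> k + \<alpha> = \<alpha>\<^sub>1 + j}" by blast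
    thus ?thesis
      by (simp only: card_subgroups_DirProd_prime_power[OF assms(1), of _ _
              "\<lambda>N. N = p ^ (\<alpha>\<^sub>1 + \<alpha>\<^sub>2 - \<alpha>)"]
            sum_power_min_diagonal[OF assms(3) \<alpha>] geo)
  qed
  have "card {H. subgroup H ?G} = (\<Sum>(k, j)\<in>{..\<alpha>\<^sub>1} \<times> {..\<alpha>\<^sub>2}. p ^ min k j)"
  proof -
    have "{..\<alpha>\<^sub>1} \<times> {..\<alpha>\<^sub>2} = {(k, j). k \<le> \<alpha>\<^sub>1 \<and> j \<le> \<alpha>\<^sub>2 \<and> True}" by auto
    thus ?thesis
      using card_subgroups_DirProd_prime_power[OF assms(1), of \<alpha>\<^sub>1 \<alpha>\<^sub>2 "\<lambda>_. True"] by simp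
  qed
  hence "real (card {H. subgroup H ?G}) = (\<Sum>k\<le>\<alpha>\<^sub>1. \<Sum>j\<le>\<alpha>\<^sub>2. real p ^ min k j)"
    by (simp add: sum.cartesian_product case_prod_unfold)
  hence "real (card {H. subgroup H ?G})
        = 1 / (real p - 1)\<^sup>2 * ((real p - 1)\<^sup>2 * (\<Sum>k\<le>\<alpha>\<^sub>1. \<Sum>j\<le>\<alpha>\<^sub>2. real p ^ min k j))"
    using p by simp
  note total = this[unfolded sum_power_min_rectangle[OF assms(3)]]
  show ?thesis
  proof (intro conjI allI impI, unfold Let_def, intro conjI impI)
    fix \<alpha> assume \<alpha>: "\<alpha> \<le> \<alpha>\<^sub>1 + \<alpha>\<^sub>2"
    note N = N[OF \<alpha>]
    show "real (card {H. subgroup H ?G \<and> card H = p ^ (\<alpha>\<^sub>1 + \<alpha>\<^sub>2 - \<alpha>)})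
          = (real p ^ (\<alpha> + 1) - 1) / (real p - 1)" if "\<alpha> \<le> \<alpha>\<^sub>1"
    proof -
      have "min \<alpha> (min \<alpha>\<^sub>1 (\<alpha>\<^sub>1 + \<alpha>\<^sub>2 - \<alpha>)) = \<alpha>" using that assms(3) by linarith
      thus ?thesis unfolding N by simp
    qed
    show "real (card {H. subgroup H ?G \<and> card H = p ^ (\<alpha>\<^sub>1 + \<alpha>\<^sub>2 - \<alpha>)})
          = (real p ^ (\<alpha>\<^sub>1 + 1) - 1) / (real p - 1)" if "\<alpha>\<^sub>1 \<le> \<alpha> \<and> \<alpha> \<le> \<alpha>\<^sub>2"
    proof -
      have "min \<alpha> (min \<alpha>\<^sub>1 (\<alpha>\<^sub>1 + \<alpha>\<^sub>2 - \<alpha>)) = \<alpha>\<^sub>1" using that assms(3) by linarith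
      thus ?thesis unfolding N by simp
    qed
    show "real (card {H. subgroup H ?G \<and> card H = p ^ (\<alpha>\<^sub>1 + \<alpha>\<^sub>2 - \<alpha>)})
          = (real p ^ (\<alpha>\<^sub>1 + \<alpha>\<^sub>2 - \<alpha> + 1) - 1) / (real p - 1)" if "\<alpha>\<^sub>2 \<le> \<alpha>"
    proof -
      have "min \<alpha> (min \<alpha>\<^sub>1 (\<alpha>\<^sub>1 + \<alpha>\<^sub>2 - \<alpha>)) = \<alpha>\<^sub>1 + \<alpha>\<^sub>2 - \<alpha>" using that assms(3) by linarith
      thus ?thesis unfolding N by simp
    qed
  qed (rule total)
qed

end
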